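(* Let $\tau$ be a finite relational vocabulary, $\mathcal{Q}$ a finite set of generalized quantifiers of width $1$ and type $(1)$, and let $\mathcal{A}$ and $\mathcal{B}$ be finite classes of $\tau$-pairs. Then $\mathcal{A}$ and $\mathcal{B}$ are separable in $\mathrm{FO}(\mathcal{Q})$ if and only if they are weakly separable in $\mathrm{FO}(\mathcal{Q})$.
   Context: **Logic.** $\tau$ is a finite set of relation symbols with arities in $\mathbb{N}$. A $\tau$-model $\mathfrak{A}$ has a non-empty, possibly infinite domain $A$ and a relation $R^{\mathfrak{A}}\subseteq A^k$ for each $k$-ary $R\in\tau$. $\mathrm{VAR}$ is a countably infinite set of variables. An assignment over $\mathfrak{A}$ is a (possibly empty) function $f:X\to A$ with $X\subseteq\mathrm{VAR}$ finite; $f\frac{a}{x}$ is the assignment with domain $\mathrm{dom}(f)\cup\{x\}$ that maps $x$ to $a$ and agrees with $f$ elsewhere. A generalized quantifier of width $1$ and type $(1)$ is an isomorphism-closed class $Q$ of structures $(D,P)$ with $P\subseteq D$. For a finite set $\mathcal{Q}$ of these (which need not contain $\exists$ or $\forall$), $\mathrm{FO}(\mathcal{Q})$ is built from the atomic formulas $x=y$ and $R(x_1,\dots,x_k)$ using $\neg$, $\land$ (with $\lor$ as an abbreviation) and $Qx\,\varphi$ for $Q\in\mathcal{Q}$, $x\in\mathrm{VAR}$. Semantics: atoms and connectives as usual, and $\mathfrak{A},f\models Qx\,\varphi$ iff $(A,\|\varphi\|^{\mathfrak{A},f}_x)\in Q$, where $\|\varphi\|^{\mathfrak{A},f}_x=\{a\in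 A\mid \mathfrak{A},f\frac{a}{x}\models\varphi\}$; here $\mathrm{dom}(f)$ contains all free variables of the formula being evaluated. **Separability.** A $\tau$-pair is a pair $(\mathfrak{A},f)$ with $\mathfrak{A}$ a $\tau$-model and $f$ an assignment over $\mathfrak{A}$. Classes $\mathcal{A},\mathcal{B}$ of $\tau$-pairs are *separable* in $\mathrm{FO}(\mathcal{Q})$ if there is a single $\varphi\in\mathrm{FO}(\mathcal{Q})$ with $\mathfrak{A},f\models\varphi$ for all $(\mathfrak{A},f)\in\mathcal{A}$ and $\mathfrak{B},g\not\models\varphi$ for all $(\mathfrak{B},g)\in\mathcal{B}$; classes may be empty, and the empty class counts as separable from any class, including itself. They are *weakly separable* in $\mathrm{FO}(\mathcal{Q})$ if for all $(\mathfrak{A},f)\in\mathcal{A}$ and $(\mathfrak{B},g)\in\mathcal{B}$ there is a $\varphi\in\mathrm{FO}(\mathcal{Q})$ with $\mathfrak{A},f\models\varphi$ and $\mathfrak{B},g\not\models\varphi$.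
   Formalization: In both notions only formulas whose free variables lie in the domain of every assignment in the two classes are allowed; if weak separability could use variables common only to the two given pairs, the claim would fail when assignment domains differ. *)

theory Defs
  imports Main
begin

type_synonym var = nat

text \<open>A relational vocabulary maps each of its symbols to its arity (possibly 0).\<close>
type_synonym 'r vocabulary = "'r \<rightharpoonup> nat"

record ('a, 'r) model =
  univ :: "'a set"
  rel :: "'r \<Rightarrow> 'a list set"

text \<open>
  The universe is an arbitrary non-empty subset of the type \<open>'a\<close>, so models of different
  cardinalities live over the same type, and any finite class of models fits (up to isomorphism)
  into one such type. Symbols outside the vocabulary get the empty relation, so that the
  representation of a model is unique.
\<close>
definition is_model :: "'r vocabulary \<Rightarrow> ('a, 'r) model \<Rightarrow> bool" where
  "is_model \<tau> M \<longleftrightarrow> univ M \<noteq> {} \<and>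
     (\<forall>R k. \<tau> R = Some k \<longrightarrow> rel M R \<subseteq> {as. length as = k \<and> set as \<subseteq> univ M}) \<and>
     (\<forall>R. \<tau> R = None \<longrightarrow> rel M R = {})"

type_synonym 'a assignment = "var \<rightharpoonup> 'a"

definition is_assignment :: "('a, 'r) model \<Rightarrow> 'a assignment \<Rightarrow> bool" where
  "is_assignment M f \<longleftrightarrow> finite (dom f) \<and> ran f \<subseteq> univ M"

type_synonym ('a, 'r) tau_pair = "('a, 'r) model \<times> 'a assignment"

definition is_tau_pair :: "'r vocabulary \<Rightarrow> ('a, 'r) tau_pair \<Rightarrow> bool" where
  "is_tau_pair \<tau> p \<longleftrightarrow> is_model \<tau> (fst p) \<and> is_assignment (fst p) (snd p)"

type_synonym 'a quantifier = "('a set \<times> 'a set) set"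

text \<open>
  Width 1 and type (1). Closure under isomorphism is stated for structures with universe in \<open>'a\<close>;
  these are exactly the restrictions to \<open>'a\<close> of isomorphism-closed classes.
\<close>
definition generalized_quantifier :: "'a quantifier \<Rightarrow> bool" where
  "generalized_quantifier Q \<longleftrightarrow>
     (\<forall>D P. (D, P) \<in> Q \<longrightarrow> P \<subseteq> D) \<and>
     (\<forall>D P D' h. (D, P) \<in> Q \<longrightarrow> bij_betw h D D' \<longrightarrow> (D', h ` P) \<in> Q)"

text \<open>The quantifier classes themselves serve as the quantifier symbols.\<close>
datatype ('a, 'r) formula =
    Eq var var
  | Rel 'r "var list"
  | Neg "('a, 'r) formula"
  | Conj "('a, 'r) formula" "('a, 'r) formula"
  | Quant "('a set \<times> 'a set) set" var "('a, 'r) formula"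

primrec free_vars :: "('a, 'r) formula \<Rightarrow> var set" where
  "free_vars (Eq x y) = {x, y}"
| "free_vars (Rel R xs) = set xs"
| "free_vars (Neg \<phi>) = free_vars \<phi>"
| "free_vars (Conj \<phi> \<psi>) = free_vars \<phi> \<union> free_vars \<psi>"
| "free_vars (Quant Q x \<phi>) = free_vars \<phi> - {x}"

primrec is_formula :: "'r vocabulary \<Rightarrow> 'a quantifier set \<Rightarrow> ('a, 'r) formula \<Rightarrow> bool" where
  "is_formula \<tau> \<Q> (Eq x y) \<longleftrightarrow> True"
| "is_formula \<tau> \<Q> (Rel R xs) \<longleftrightarrow> \<tau> R = Some (length xs)"
| "is_formula \<tau> \<Q> (Neg \<phi>) \<longleftrightarrow> is_formula \<tau> \<Q> \<phi>"
| "is_formula \<tau> \<Q> (Conj \<phi> \<psi>) \<longleftrightarrow> is_formula \<tau> \<Q> \<phi> \<and> is_formula \<tau> \<Q> \<psi>"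
| "is_formula \<tau> \<Q> (Quant Q x \<phi>) \<longleftrightarrow> Q \<in> \<Q> \<and> is_formula \<tau> \<Q> \<phi>"

text \<open>Only meaningful when the free variables of the formula lie in \<open>dom f\<close>.\<close>
primrec sat :: "('a, 'r) model \<Rightarrow> 'a assignment \<Rightarrow> ('a, 'r) formula \<Rightarrow> bool" where
  "sat M f (Eq x y) \<longleftrightarrow> the (f x) = the (f y)"
| "sat M f (Rel R xs) \<longleftrightarrow> map (\<lambda>x. the (f x)) xs \<in> rel M R"
| "sat M f (Neg \<phi>) \<longleftrightarrow> \<not> sat M f \<phi>"
| "sat M f (Conj \<phi> \<psi>) \<longleftrightarrow> sat M f \<phi> \<and> sat M f \<psi>"
| "sat M f (Quant Q x \<phi>) \<longleftrightarrow> (univ M, {a \<in> univ M. sat M (f(x \<mapsto> a)) \<phi>}) \<in> Q"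

text \<open>
  The formulas of FO(\<open>\<Q>\<close>) that can be evaluated under every assignment occurring in the class
  \<open>\<C>\<close> of pairs. If all assignments in \<open>\<C>\<close> have the same domain \<open>X\<close>, these are the formulas with
  free variables in \<open>X\<close>. For mismatched domains, weak separability has to be understood relative
  to these formulas: with no quantifiers, \<open>P(x)\<close> and \<open>P(y)\<close> may distinguish pairs with domains
  \<open>{x}\<close> and \<open>{y}\<close> from one with domain \<open>{x, y}\<close>, although no formula at all can be evaluated on
  all three.
\<close>
definition FO :: "'r vocabulary \<Rightarrow> 'a quantifier set \<Rightarrow> ('a, 'r) tau_pair set
    \<Rightarrow> ('a, 'r) formula set" where
  "FO \<tau> \<Q> \<C> = {\<phi>. is_formula \<tau> \<Q> \<phi> \<and> (\<forall>(M, f) \<in> \<C>. free_vars \<phi> \<subseteq> dom f)}"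

text \<open>
  The case of an empty class is a convention: with no quantifiers, no 0-ary symbols and an empty
  assignment there is no formula that can be evaluated at all.
\<close>
definition separable :: "('a, 'r) formula set \<Rightarrow> ('a, 'r) tau_pair set \<Rightarrow> ('a, 'r) tau_pair set
    \<Rightarrow> bool" where
  "separable L \<A> \<B> \<longleftrightarrow> \<A> = {} \<or> \<B> = {} \<or>
     (\<exists>\<phi>\<in>L. (\<forall>(A, f)\<in>\<A>. sat A f \<phi>) \<and> (\<forall>(B, g)\<in>\<B>. \<not> sat B g \<phi>))"

definition weakly_separable :: "('a, 'r) formula set \<Rightarrow> ('a, 'r) tau_pair set
    \<Rightarrow> ('a, 'r) tau_pair set \<Rightarrow> bool" where
  "weakly_separable L \<A> \<B> \<longleftrightarrow>
     (\<forall>(A, f)\<in>\<A>. \<forall>(B, g)\<in>\<B>. \<exists>\<phi>\<in>L. sat A f \<phi> \<and> \<not> sat B g \<phi>)"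

end

theory Submission
  imports Defs
begin

text \<open>
  The reason is closure under Boolean connectives. For non-empty \<open>\<A>\<close> and \<open>\<B>\<close>, if some formula
  \<open>\<phi>\<^sub>p\<^sub>q\<close> is true in \<open>p\<close> and false in \<open>q\<close>, for each \<open>(p, q) \<in> \<A> \<times> \<B>\<close>, then the formula
  \<open>\<Or>\<^sub>p \<And>\<^sub>q \<phi>\<^sub>p\<^sub>q\<close> separates the two classes, and it is a formula because both classes are finite. It can be evaluated on every pair of \<open>\<A> \<union> \<B>\<close>
  since each \<open>\<phi>\<^sub>p\<^sub>q\<close> can.

  Adding elements one at a time replaces the explicit formula: the inner conjunction is
  \<open>separable_Un_right\<close>, which extends the second class. The outer disjunction is its mirror image
  \<open>separable_Un_left\<close>, obtained by de Morgan, that is, by negating the separating formula and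
  exchanging the classes.
\<close>

lemma separable_Un_right:
  assumes conj: "\<And>\<phi> \<psi>. \<phi> \<in> L \<Longrightarrow> \<psi> \<in> L \<Longrightarrow> Conj \<phi> \<psi> \<in> L"
    and B: "separable L \<A> \<B>"
    and C: "separable L \<A> \<C>"
  shows "separable L \<A> (\<B> \<union> \<C>)"
proof (cases "\<A> = {} \<or> \<B> = {} \<or> \<C> = {}")
  case True
  then show ?thesis
    using B C by (auto simp: separable_def)
next
  case False
  obtain \<phi> where \<phi>: "\<phi> \<in> L" "\<forall>(M, f)\<in>\<A>. sat M f \<phi>" "\<forall>(M, f)\<in>\<B>. \<not> sat M f \<phi>"
    using B False unfolding separable_def by blast
  obtain \<psi> where \<psi>: "\<psi> \<in> L" "\<forall>(M, f)\<in>\<A>. sat M f \<psi>" "\<forall>(M, f)\<in>\<C>. \<not> sat M f \<psi>"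
    using C False unfolding separable_def by blast
  have "Conj \<phi> \<psi> \<in> L"
    using conj \<phi>(1) \<psi>(1) .
  moreover have "\<forall>(M, f)\<in>\<A>. sat M f (Conj \<phi> \<psi>)"
    using \<phi>(2) \<psi>(2) by auto
  moreover have "\<forall>(M, f)\<in>\<B> \<union> \<C>. \<not> sat M f (Conj \<phi> \<psi>)"
    using \<phi>(3) \<psi>(3) by auto
  ultimately show ?thesis
    unfolding separable_def by blast
qed

lemma separable_commute:
  assumes neg: "\<And>\<phi>. \<phi> \<in> L \<Longrightarrow> Neg \<phi> \<in> L"
    and sep: "separable L \<A> \<B>"
  shows "separable L \<B> \<A>"
proof (cases "\<A> = {} \<or> \<B> = {}")
  case True
  then show ?thesis
    by (auto simp: separable_def)
next
  case False
  then obtain \<phi> where \<phi>: "\<phi> \<in> L" "\<forall>(M, f)\<in>\<A>. sat M f \<phi>" "\<forall>(M, f)\<in>\<B>. \<not> sat M f \<phi>"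
    using sep unfolding separable_def by blast
  have "\<forall>(M, f)\<in>\<B>. sat M f (Neg \<phi>)" "\<forall>(M, f)\<in>\<A>. \<not> sat M f (Neg \<phi>)"
    using \<phi>(2,3) by auto
  then show ?thesis
    using neg[OF \<phi>(1)] unfolding separable_def by blast
qed

lemma separable_Un_left:
  assumes neg: "\<And>\<phi>. \<phi> \<in> L \<Longrightarrow> Neg \<phi> \<in> L"
    and conj: "\<And>\<phi> \<psi>. \<phi> \<in> L \<Longrightarrow> \<psi> \<in> L \<Longrightarrow> Conj \<phi> \<psi> \<in> L"
    and "separable L \<A> \<C>" "separable L \<B> \<C>"
  shows "separable L (\<A> \<union> \<B>) \<C>"
  using assms by (blast intro: separable_commute separable_Un_right)

lemma weakly_separable_iff_singletons:
  "weakly_separable L \<A> \<B> \<longleftrightarrow> (\<forall>p\<in>\<A>. \<forall>q\<in>\<B>. separable L {p} {q})"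
  by (fastforce simp: weakly_separable_def separable_def)

theorem separable_iff_weakly_separable:
  assumes neg: "\<And>\<phi>. \<phi> \<in> L \<Longrightarrow> Neg \<phi> \<in> L"
    and conj: "\<And>\<phi> \<psi>. \<phi> \<in> L \<Longrightarrow> \<psi> \<in> L \<Longrightarrow> Conj \<phi> \<psi> \<in> L"
    and finA: "finite \<A>"
    and finB: "finite \<B>"
  shows "separable L \<A> \<B> \<longleftrightarrow> weakly_separable L \<A> \<B>"
proof
  assume "separable L \<A> \<B>"
  then show "weakly_separable L \<A> \<B>"
    unfolding separable_def weakly_separable_def by fast
next
  assume weak: "weakly_separable L \<A> \<B>"
  \<comment> \<open>Both inductions start at the empty class, which is separable from any class by convention,
    even when \<open>L\<close> has no formulas.\<close>
  have point: "separable L {p} \<B>" if "p \<in> \<A>" for p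
  proof -
    have "\<forall>q\<in>\<B>. separable L {p} {q}"
      using weak that by (simp add: weakly_separable_iff_singletons)
    with finB show ?thesis
    proof (induction rule: finite_induct)
      case empty
      show ?case
        by (simp add: separable_def)
    next
      case (insert q \<C>)
      then have "separable L {p} ({q} \<union> \<C>)"
        by (intro separable_Un_right conj) auto
      then show ?case
        by simp
    qed
  qed
  then have "\<forall>p\<in>\<A>. separable L {p} \<B>"
    by blast
  with finA show "separable L \<A> \<B>"
  proof (induction rule: finite_induct)
    case empty
    show ?case
      by (simp add: separable_def)
  next
    case (insert p \<C>)
    then have "separable L ({p} \<union> \<C>) \<B>"
      by (intro separable_Un_left neg conj) auto
    then show ?case
      by simp
  qed
qed

theorem theorem4p6:
  fixes \<tau> :: "'r vocabulary"
    and \<Q> :: "'a quantifier set"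
    and \<A> \<B> :: "('a, 'r) tau_pair set"
  assumes "finite (dom \<tau>)"
    and "finite \<Q>"
    and "\<And>Q. Q \<in> \<Q> \<Longrightarrow> generalized_quantifier Q"
    and "finite \<A>"
    and "\<And>p. p \<in> \<A> \<Longrightarrow> is_tau_pair \<tau> p"
    and "finite \<B>"
    and "\<And>p. p \<in> \<B> \<Longrightarrow> is_tau_pair \<tau> p"
  shows "separable (FO \<tau> \<Q> (\<A> \<union> \<B>)) \<A> \<B> \<longleftrightarrow> weakly_separable (FO \<tau> \<Q> (\<A> \<union> \<B>)) \<A> \<B>"
proof (rule separable_iff_weakly_separable)
  show "Neg \<phi> \<in> FO \<tau> \<Q> (\<A> \<union> \<B>)" if "\<phi> \<in> FO \<tau> \<Q> (\<A> \<union> \<B>)" for \<phi>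
    using that by (simp add: FO_def)
  show "Conj \<phi> \<psi> \<in> FO \<tau> \<Q> (\<A> \<union> \<B>)"
    if "\<phi> \<in> FO \<tau> \<Q> (\<A> \<union> \<B>)" "\<psi> \<in> FO \<tau> \<Q> (\<A> \<union> \<B>)" for \<phi> \<psi>
    using that by (simp add: FO_def case_prod_beta)
qed (fact assms)+

end
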